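(* Let $r,\ell\in[0,\infty)$ be the asymmetry parameters of the headway exclusion process (HEP). (a) Fix arbitrarily an interaction potential $J$, i.e. $J(0)=\infty$ and $J(n)\in\mathbb{R}\cup\{\infty\}$ for $n\in\mathbb{N}$, satisfying $J(k)\neq\infty$ for all $k\in\mathbb{N}$. Let $\{w_k\}_{k\in\mathbb{N}_0}$ be given by this potential via $$w_0=0,\qquad w_n=w\,e^{J(n+1)-J(n)}\quad(n\in\mathbb{N}),\qquad(\ast)$$ where $w$ is an arbitrary strictly positive real number. Let $L\in\mathbb{N}$ and $N\in\{0,\dots,L\}$ be arbitrary and consider the HEP with $N$ particles on $\mathbb{T}_L$ with particle jump rates $\{w_k\}$. Then, for any value of the fugacity $z$, the grand canonical headway measure $\mu^{gc}_{L,z}$ corresponding to $J$ is invariant for the HEP. (b) If $\mu^{gc}_{L,z}$, corresponding to some interaction potential $J$ with $J(0)=\infty$ and $J(k)\neq\infty$ for all $k\in\mathbb{N}$ and to some arbitrary value of the fugacity $z$, is invariant for the HEP for every lattice size $L$ and every particle number $N\in\{0,\dots,L\}$, then there exists $w\in(0,\infty)$ such that the particle jump rates $\{w_k\}_{k\in\mathbb{N}_0}$ of the HEP are related to the potential via $(\ast)$.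
   Context: $\mathbb{N}=\{1,2,\dots\}$, $\mathbb{N}_0=\{0,1,2,\dots\}$, $\mathbb{T}_L=\mathbb{Z}/L\mathbb{Z}$ with sites $0,\dots,L-1$ (site indices are taken modulo $L$). Configurations: $\Omega^{gc}_L=\{0,1\}^L$, $\boldsymbol\eta=(\eta_0,\dots,\eta_{L-1})$, where $\eta_x=1$ means that site $x$ is occupied by a particle. Particle number $\mathcal{N}(\boldsymbol\eta)=\sum_x\eta_x$; $\Omega^{can}_{L,N}=\{\boldsymbol\eta\in\Omega^{gc}_L:\mathcal{N}(\boldsymbol\eta)=N\}$. The headway of a particle is the number of empty sites between it and the next particle to its right on the torus; if there is a single particle, its headway is $L-1$. Headway indicator: $h_{x,n}(\boldsymbol\eta)=1$ if $\eta_x=1$ and the headway of the particle at $x$ is $n$, and $h_{x,n}(\boldsymbol\eta)=0$ otherwise ($0\le n\le L-1$). HEP on $\mathbb{T}_L$ with parameters $r,\ell\in[0,\infty)$ and jump rates $\{w_n\}_{n\in\mathbb{N}_0}$, where $w_0=0$ and the $w_n$, $n\in\mathbb{N}$, are positive parameters; the jump rates do not depend on $L$ or on the particle number. It is the continuous-time Markov chain on $\Omega^{gc}_L$ with generator $$(\mathcal{L}f)(\boldsymbol\eta)=\sum_{x\in\mathbb{T}_L}\left\{r\,c^+_x(\boldsymbol\eta)[f(\boldsymbol\eta^{x,x+1})-f(\boldsymbol\eta)]+\ell\, c^-_x(\boldsymbol\eta)[f(\boldsymbol\eta^{x,x-1})-f(\boldsymbol\eta)]\right\},$$ $$c^+_x(\boldsymbol\eta)=\sum_{n=0}^{L-1}w_nh_{x,n}(\boldsymbol\eta),\qquad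 c^-_x(\boldsymbol\eta)=\sum_{n=0}^{L-1}w_nh_{(x-1-n)\bmod L,\,n}(\boldsymbol\eta),$$ where $\boldsymbol\eta^{x,y}$ is $\boldsymbol\eta$ with the occupation numbers at $x$ and $y$ exchanged. The dynamics conserves the particle number; the process restricted to $\Omega^{can}_{L,N}$ is the HEP with $N$ particles. Headway measures: for a potential $J$ put $y_0=0$ and $y_k=e^{-J(k)}$ for $k\geq 1$, and define the Boltzmann weight $\pi_L(\boldsymbol\eta)=\prod_{x=0}^{L-1}\prod_{n=0}^{L-1}y_{n+1}^{h_{x,n}(\boldsymbol\eta)}$. The grand canonical headway measure with fugacity $z\in[0,\infty)$ is the probability measure on $\Omega^{gc}_L$ given by $\mu^{gc}_{L,z}(\boldsymbol\eta)=z^{\mathcal{N}(\boldsymbol\eta)}\pi_L(\boldsymbol\eta)/Z^{gc}_{L,z}$, with $Z^{gc}_{L,z}=\sum_{\boldsymbol\eta\in\Omega^{gc}_L}z^{\mathcal{N}(\boldsymbol\eta)}\pi_L(\boldsymbol\eta)$ (with $0^0=1$).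
   Formalization: Part (b) is stated for fugacity z > 0 and r + ℓ > 0; for z = 0 (point mass at the empty configuration) or r = ℓ = 0 (no dynamics) the measure is invariant for all jump rates, so (b) fails there. *)

theory Defs
  imports Complex_Main "HOL-Library.FuncSet" "HOL-Library.Extended_Real"
begin

text \<open>
  The sites of the torus with \<open>L\<close> sites are the naturals below \<open>L\<close>, with arithmetic modulo \<open>L\<close>.
  Configurations are extensional functions on the sites.
\<close>

type_synonym config = "nat \<Rightarrow> nat"

definition Omega_gc :: "nat \<Rightarrow> config set" where
  "Omega_gc L = {..<L} \<rightarrow>\<^sub>E {0, 1}"

definition num_particles :: "nat \<Rightarrow> config \<Rightarrow> nat" where
  "num_particles L \<eta> = (\<Sum>x<L. \<eta> x)"

definition Omega_can :: "nat \<Rightarrow> nat \<Rightarrow> config set" where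
  "Omega_can L N = {\<eta> \<in> Omega_gc L. num_particles L \<eta> = N}"

text \<open>
  Number of empty sites between \<open>x\<close> and the first occupied site to its right.  It is used only when
  \<open>x\<close> is occupied; the search then ends after at most \<open>L - 1\<close> empty sites, at \<open>x\<close> itself if there
  is no other particle, so a single particle has headway \<open>L - 1\<close>.
\<close>

definition headway :: "nat \<Rightarrow> config \<Rightarrow> nat \<Rightarrow> nat" where
  "headway L \<eta> x = (LEAST n. \<eta> ((x + 1 + n) mod L) = 1)"

definition headway_ind :: "nat \<Rightarrow> config \<Rightarrow> nat \<Rightarrow> nat \<Rightarrow> nat" where
  "headway_ind L \<eta> x n = (if \<eta> x = 1 \<and> headway L \<eta> x = n then 1 else 0)"

definition exchange :: "config \<Rightarrow> nat \<Rightarrow> nat \<Rightarrow> config" where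
  "exchange \<eta> x y = \<eta>(x := \<eta> y, y := \<eta> x)"

definition rate_right :: "nat \<Rightarrow> (nat \<Rightarrow> real) \<Rightarrow> config \<Rightarrow> nat \<Rightarrow> real" where
  "rate_right L w \<eta> x = (\<Sum>n<L. w n * real (headway_ind L \<eta> x n))"

text \<open>
  Below, \<open>(x + L - 1 - n) mod L\<close> is the site \<open>x - 1 - n\<close>; no truncation occurs since \<open>n < L\<close>.
\<close>

definition rate_left :: "nat \<Rightarrow> (nat \<Rightarrow> real) \<Rightarrow> config \<Rightarrow> nat \<Rightarrow> real" where
  "rate_left L w \<eta> x = (\<Sum>n<L. w n * real (headway_ind L \<eta> ((x + L - 1 - n) mod L) n))"

definition hep_generator ::
  "real \<Rightarrow> real \<Rightarrow> (nat \<Rightarrow> real) \<Rightarrow> nat \<Rightarrow> (config \<Rightarrow> real) \<Rightarrow> config \<Rightarrow> real" where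
  "hep_generator r l w L f \<eta> =
     (\<Sum>x<L. r * rate_right L w \<eta> x * (f (exchange \<eta> x ((x + 1) mod L)) - f \<eta>)
           + l * rate_left L w \<eta> x * (f (exchange \<eta> x ((x + L - 1) mod L)) - f \<eta>))"

text \<open>
  The transition semigroup of the continuous-time Markov chain: since the state space is finite, it
  is the exponential series of the generator (which converges, see \<open>summable_hep_semigroup\<close>).
\<close>

definition hep_semigroup ::
  "real \<Rightarrow> real \<Rightarrow> (nat \<Rightarrow> real) \<Rightarrow> nat \<Rightarrow> real \<Rightarrow> (config \<Rightarrow> real) \<Rightarrow> config \<Rightarrow> real" where
  "hep_semigroup r l w L t f \<eta> =
     (\<Sum>k. t ^ k / fact k * (hep_generator r l w L ^^ k) f \<eta>)"

text \<open>
  Invariance of the restriction of the measure \<open>\<mu>\<close> (given by its point weights, not necessarily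
  normalised) to the set \<open>S\<close> of states, for the chain run on \<open>S\<close>.  Here \<open>S\<close> is the full state space
  or one of the sets \<open>Omega_can L N\<close>, both of which are closed under the dynamics.
\<close>

definition hep_invariant_on ::
  "real \<Rightarrow> real \<Rightarrow> (nat \<Rightarrow> real) \<Rightarrow> nat \<Rightarrow> config set \<Rightarrow> (config \<Rightarrow> real) \<Rightarrow> bool" where
  "hep_invariant_on r l w L S \<mu> \<longleftrightarrow>
     (\<forall>t\<ge>0. \<forall>f. (\<Sum>\<eta>\<in>S. \<mu> \<eta> * hep_semigroup r l w L t f \<eta>) = (\<Sum>\<eta>\<in>S. \<mu> \<eta> * f \<eta>))"

definition jump_rates :: "(nat \<Rightarrow> real) \<Rightarrow> bool" where
  "jump_rates w \<longleftrightarrow> w 0 = 0 \<and> (\<forall>n\<ge>1. 0 < w n)"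

definition interaction_potential :: "(nat \<Rightarrow> ereal) \<Rightarrow> bool" where
  "interaction_potential J \<longleftrightarrow> J 0 = \<infinity> \<and> (\<forall>n\<ge>1. J n \<noteq> -\<infinity>)"

definition boltzmann_factor :: "(nat \<Rightarrow> ereal) \<Rightarrow> nat \<Rightarrow> real" where
  "boltzmann_factor J k =
     (if k = 0 \<or> J k = \<infinity> then 0 else exp (- real_of_ereal (J k)))"

definition headway_weight :: "(nat \<Rightarrow> ereal) \<Rightarrow> nat \<Rightarrow> config \<Rightarrow> real" where
  "headway_weight J L \<eta> =
     (\<Prod>x<L. \<Prod>n<L. boltzmann_factor J (n + 1) ^ headway_ind L \<eta> x n)"

definition gc_partition :: "(nat \<Rightarrow> ereal) \<Rightarrow> nat \<Rightarrow> real \<Rightarrow> real" where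
  "gc_partition J L z = (\<Sum>\<eta>\<in>Omega_gc L. z ^ num_particles L \<eta> * headway_weight J L \<eta>)"

definition mu_gc :: "(nat \<Rightarrow> ereal) \<Rightarrow> nat \<Rightarrow> real \<Rightarrow> config \<Rightarrow> real" where
  "mu_gc J L z \<eta> = z ^ num_particles L \<eta> * headway_weight J L \<eta> / gc_partition J L z"

definition rates_of_potential :: "(nat \<Rightarrow> ereal) \<Rightarrow> real \<Rightarrow> (nat \<Rightarrow> real) \<Rightarrow> bool" where
  "rates_of_potential J c w \<longleftrightarrow>
     w 0 = 0 \<and> (\<forall>n\<ge>1. w n = c * exp (real_of_ereal (J (n + 1) - J n)))"


lemma exchange_in_Omega_gc:
  assumes "\<eta> \<in> Omega_gc L" "x < L" "y < L"
  shows "exchange \<eta> x y \<in> Omega_gc L"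
proof -
  have \<eta>: "\<eta> \<in> {..<L} \<rightarrow>\<^sub>E {0, 1}"
    using assms(1) by (simp only: Omega_gc_def)
  have "\<eta>(x := \<eta> y, y := \<eta> x) \<in> insert y (insert x {..<L}) \<rightarrow>\<^sub>E {0, 1}"
    using assms(2,3) by (intro PiE_fun_upd PiE_mem[OF \<eta>]) (simp_all only: lessThan_iff \<eta>)
  moreover have "insert y (insert x {..<L}) = {..<L}"
    using assms(2,3) by (simp add: insert_absorb)
  ultimately show ?thesis
    by (simp only: Omega_gc_def exchange_def)
qed

lemma finite_Omega_gc: "finite (Omega_gc L)"
  unfolding Omega_gc_def by (intro finite_PiE) auto

lemma summable_hep_semigroup:
  assumes \<eta>: "\<eta> \<in> Omega_gc L"
  shows "summable (\<lambda>k. t ^ k / fact k * (hep_generator r l w L ^^ k) f \<eta>)"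
proof -
  define A where "A = (\<lambda>\<xi>. \<Sum>x<L. \<bar>r * rate_right L w \<xi> x\<bar> + \<bar>l * rate_left L w \<xi> x\<bar>)"
  define C where "C = 2 * (\<Sum>\<xi>\<in>Omega_gc L. A \<xi>)"
  define F where "F = (\<Sum>\<xi>\<in>Omega_gc L. \<bar>f \<xi>\<bar>)"
  have A0: "0 \<le> A \<xi>" for \<xi>
    unfolding A_def by (intro sum_nonneg) auto
  have AC: "2 * A \<xi> \<le> C" if "\<xi> \<in> Omega_gc L" for \<xi>
    unfolding C_def using member_le_sum[of \<xi> "Omega_gc L" A] that finite_Omega_gc A0 by auto
  have step: "\<bar>hep_generator r l w L g \<xi>\<bar> \<le> C * M"
    if g: "\<And>\<zeta>. \<zeta> \<in> Omega_gc L \<Longrightarrow> \<bar>g \<zeta>\<bar> \<le> M" and \<xi>: "\<xi> \<in> Omega_gc L" for g M \<xi>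
  proof -
    have M0: "0 \<le> M" using g[OF \<xi>] by linarith
    have term_le: "\<bar>a * (g (exchange \<xi> x y) - g \<xi>)\<bar> \<le> \<bar>a\<bar> * (2 * M)"
      if "x < L" "y < L" for a x y
      unfolding abs_mult
      using g[OF \<xi>] g[OF exchange_in_Omega_gc[OF \<xi> that]]
      by (intro mult_left_mono) auto
    have "\<bar>hep_generator r l w L g \<xi>\<bar>
        \<le> (\<Sum>x<L. \<bar>r * rate_right L w \<xi> x\<bar> * (2 * M) + \<bar>l * rate_left L w \<xi> x\<bar> * (2 * M))"
      unfolding hep_generator_def
      by (intro order_trans[OF sum_abs] sum_mono order_trans[OF abs_triangle_ineq] add_mono term_le)
         auto
    also have "\<dots> = 2 * A \<xi> * M"
      unfolding A_def by (simp add: sum_distrib_left sum_distrib_right algebra_simps)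
    also have "\<dots> \<le> C * M"
      using AC[OF \<xi>] M0 by (rule mult_right_mono)
    finally show ?thesis .
  qed
  have bound: "\<bar>(hep_generator r l w L ^^ k) f \<xi>\<bar> \<le> C ^ k * F" if "\<xi> \<in> Omega_gc L" for k \<xi>
    using that
  proof (induction k arbitrary: \<xi>)
    case 0
    then show ?case
      unfolding F_def using member_le_sum[of \<xi> "Omega_gc L" "\<lambda>\<xi>. \<bar>f \<xi>\<bar>"] finite_Omega_gc by auto
  next
    case (Suc k)
    then show ?case using step[of "(hep_generator r l w L ^^ k) f" "C ^ k * F"] by (simp add: mult.assoc)
  qed
  have "summable (\<lambda>k. F * (inverse (fact k) * (\<bar>t\<bar> * C) ^ k))"
    by (intro summable_mult summable_exp)
  moreover have "norm (t ^ k / fact k * (hep_generator r l w L ^^ k) f \<eta>)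
      \<le> F * (inverse (fact k) * (\<bar>t\<bar> * C) ^ k)" for k
    using mult_left_mono[OF bound[OF \<eta>, of k], of "\<bar>t\<bar> ^ k / fact k"]
    by (simp add: abs_mult power_abs power_mult_distrib divide_inverse mult_ac)
  ultimately show ?thesis
    by (rule summable_comparison_test'[where N = 0])
qed

end

theory Submission
  imports Defs "HOL-Number_Theory.Cong"
begin

text \<open>
  If a particle with headway \<open>n\<close> behind which there is a headway \<open>m\<close> jumps to the right, these
  headways become \<open>n - 1\<close> and \<open>m + 1\<close>.  With \<open>y k = exp (- J k)\<close>, the relation between the rates
  and the potential reads \<open>w n * y (n + 1) = c * y n\<close>, so the weight times the jump rate is
  proportional to \<open>y n * y (m + 1)\<close>, and the same holds for the reverse jump to the left.  Since
  moreover both total jump rates out of a configuration (for \<open>r = l = 1\<close>) are the sum of \<open>w\<close> over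
  all headways, the measure is stationary for all \<open>r\<close> and \<open>l\<close>.

  For the converse let \<open>v\<close> be the rates given by \<open>J\<close>, with \<open>c\<close> chosen such that \<open>v 1 = w 1\<close>.  The
  measure is stationary for the generators with rates \<open>w\<close> and \<open>v\<close>, hence for the one with rates
  \<open>d = w - v\<close>.  Two adjacent particles on \<open>b + 2\<close> sites leave this configuration at rate
  \<open>(r + l) * d b\<close> and enter it at rates proportional to \<open>d 1 = 0\<close>; therefore \<open>d b = 0\<close>.
\<close>

section \<open>Particles, headways and the successor map on the torus\<close>

lemma add_right_cancel_mod:
  fixes a b c L :: nat
  assumes "(a + c) mod L = (b + c) mod L"
  shows "a mod L = b mod L"
  using assms cong_add_rcancel_nat[of a c b L] by (simp add: cong_def)

definition particles :: "nat \<Rightarrow> config \<Rightarrow> nat set" where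
  "particles L \<eta> = {x. x < L \<and> \<eta> x = 1}"

text \<open>Weights and right rates belong to the left end of a gap, left rates to its right end.
  This map translates between the two.\<close>

definition next_particle :: "nat \<Rightarrow> config \<Rightarrow> nat \<Rightarrow> nat" where
  "next_particle L \<eta> x = (x + 1 + headway L \<eta> x) mod L"

lemma finite_particles: "finite (particles L \<eta>)"
  unfolding particles_def by simp

lemma headway_less:
  assumes "x \<in> particles L \<eta>"
  shows "headway L \<eta> x < L"
proof -
  have "\<eta> ((x + 1 + (L - 1)) mod L) = 1"
    using assms by (simp add: particles_def)
  then have "headway L \<eta> x \<le> L - 1"
    unfolding headway_def by (rule Least_le)
  moreover have "0 < L" using assms by (auto simp: particles_def)
  ultimately show ?thesis by linarith
qed

lemma next_particle_in_particles:
  assumes "x \<in> particles L \<eta>"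
  shows "next_particle L \<eta> x \<in> particles L \<eta>"
proof -
  have "\<eta> ((x + 1 + (L - 1)) mod L) = 1"
    using assms by (simp add: particles_def)
  then have "\<eta> ((x + 1 + headway L \<eta> x) mod L) = 1"
    unfolding headway_def by (rule LeastI)
  then show ?thesis using assms by (simp add: particles_def next_particle_def)
qed

lemma not_occupied_before_headway:
  "j < headway L \<eta> x \<Longrightarrow> \<eta> ((x + 1 + j) mod L) \<noteq> 1"
  unfolding headway_def by (rule not_less_Least)

lemma headway_eqI:
  assumes "\<eta> ((x + 1 + k) mod L) = 1" "\<And>j. j < k \<Longrightarrow> \<eta> ((x + 1 + j) mod L) \<noteq> 1"
  shows "headway L \<eta> x = k"
  unfolding headway_def using assms by (intro Least_equality) (auto simp: not_less[symmetric])

text \<open>If two particles shared a successor, the one with the shorter headway would lie strictly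
  inside the empty stretch in front of the other, unless the headways agree and the particles
  coincide.\<close>

lemma inj_on_next_particle: "inj_on (next_particle L \<eta>) (particles L \<eta>)"
proof -
  have aux: "p = q"
    if p: "p \<in> particles L \<eta>" and q: "q \<in> particles L \<eta>"
      and eq: "next_particle L \<eta> p = next_particle L \<eta> q"
      and le: "headway L \<eta> p \<le> headway L \<eta> q" for p q
  proof -
    let ?m = "headway L \<eta> p" and ?k = "headway L \<eta> q"
    have "(p + (?m + 1)) mod L = ((q + (?k - ?m)) + (?m + 1)) mod L"
      using eq le by (simp add: next_particle_def add_ac)
    then have "p mod L = (q + (?k - ?m)) mod L"
      by (rule add_right_cancel_mod)
    then have pq: "p = (q + (?k - ?m)) mod L"
      using p by (simp add: particles_def)
    show ?thesis
    proof (cases "?m = ?k")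
      case True
      then show ?thesis using pq q by (simp add: particles_def)
    next
      case False
      \<comment> \<open>Empty sites in front of \<open>q\<close> are counted from
        \<open>q + 1\<close>, so \<open>p\<close> has offset \<open>?k - ?m - 1\<close> among
        them.\<close>
      then have "?k - ?m = 1 + (?k - ?m - 1)" "?k - ?m - 1 < ?k" using le by auto
      then have "\<eta> p \<noteq> 1"
        using not_occupied_before_headway[of "?k - ?m - 1" L \<eta> q] pq by (metis add.assoc)
      then show ?thesis using p by (simp add: particles_def)
    qed
  qed
  show ?thesis
    by (rule inj_onI) (metis aux nat_le_linear)
qed

lemma next_particle_image: "next_particle L \<eta> ` particles L \<eta> = particles L \<eta>"
  by (rule endo_inj_surj[OF finite_particles _ inj_on_next_particle])
     (use next_particle_in_particles in blast)

section \<open>Jump rates and weights as functions of the headways\<close>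

lemma rate_right_particle:
  assumes "x \<in> particles L \<eta>"
  shows "rate_right L w \<eta> x = w (headway L \<eta> x)"
proof -
  have "rate_right L w \<eta> x = (\<Sum>n<L. if n = headway L \<eta> x then w n else 0)"
    unfolding rate_right_def
    using assms by (intro sum.cong) (auto simp: headway_ind_def particles_def)
  then show ?thesis using headway_less[OF assms] by simp
qed

lemma rate_right_vacant: "\<eta> x \<noteq> 1 \<Longrightarrow> rate_right L w \<eta> x = 0"
  by (simp add: rate_right_def headway_ind_def)

text \<open>The summand with index \<open>n\<close> inspects the site \<open>s\<close> lying
  \<open>n + 1\<close> steps to the left of \<open>?y\<close>. A particle at \<open>s\<close> with
  headway \<open>n\<close> has successor \<open>?y\<close>, so injectivity of the successor map
  leaves only \<open>s = x\<close>.\<close>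

lemma rate_left_next_particle:
  assumes x: "x \<in> particles L \<eta>"
  shows "rate_left L w \<eta> (next_particle L \<eta> x) = w (headway L \<eta> x)"
proof -
  let ?y = "next_particle L \<eta> x"
  have ind: "headway_ind L \<eta> ((?y + L - 1 - n) mod L) n = (if n = headway L \<eta> x then 1 else 0)"
    if n: "n < L" for n
  proof -
    define s where "s = (?y + L - 1 - n) mod L"
    have sy: "(s + 1 + n) mod L = ?y"
    proof -
      have "(s + 1 + n) mod L = ((?y + L - 1 - n) + (1 + n)) mod L"
        unfolding s_def by (simp only: mod_add_left_eq add.assoc)
      also have "(?y + L - 1 - n) + (1 + n) = ?y + L" using n by simp
      finally show ?thesis by (simp add: next_particle_def)
    qed
    have "s = x" if h: "n = headway L \<eta> x"
    proof -
      have "(s + (1 + n)) mod L = (x + (1 + n)) mod L"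
        using sy h by (simp add: next_particle_def add_ac)
      then have "s mod L = x mod L" by (rule add_right_cancel_mod)
      then show ?thesis using x by (simp add: s_def particles_def)
    qed
    moreover have "s = x" if "\<eta> s = 1" "headway L \<eta> s = n"
    proof (rule inj_onD[OF inj_on_next_particle _ _ x])
      show "next_particle L \<eta> s = ?y" using sy that by (simp add: next_particle_def)
      show "s \<in> particles L \<eta>" using that n by (simp add: particles_def s_def)
    qed
    ultimately have "\<eta> s = 1 \<and> headway L \<eta> s = n \<longleftrightarrow> n = headway L \<eta> x"
      using x unfolding particles_def by blast
    then show ?thesis
      unfolding s_def[symmetric] headway_ind_def by (rule if_cong) simp_all
  qed
  have "rate_left L w \<eta> ?y = (\<Sum>n<L. if n = headway L \<eta> x then w n else 0)"
    unfolding rate_left_def by (intro sum.cong refl) (simp only: lessThan_iff ind, simp)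
  then show ?thesis using headway_less[OF x] by simp
qed

text \<open>A nonzero summand would exhibit a particle whose successor is the vacant site
  \<open>x\<close>.\<close>

lemma rate_left_vacant:
  assumes "x < L" "\<eta> x \<noteq> 1"
  shows "rate_left L w \<eta> x = 0"
proof -
  have "headway_ind L \<eta> ((x + L - 1 - n) mod L) n = 0" if n: "n < L" for n
  proof (rule ccontr)
    define s where "s = (x + L - 1 - n) mod L"
    assume "headway_ind L \<eta> ((x + L - 1 - n) mod L) n \<noteq> 0"
    then have s: "s \<in> particles L \<eta>" "headway L \<eta> s = n"
      using n by (auto simp: headway_ind_def s_def particles_def split: if_splits)
    have "next_particle L \<eta> s = ((x + L - 1 - n) + (1 + n)) mod L"
      unfolding next_particle_def s(2) unfolding s_def by (simp only: mod_add_left_eq add.assoc)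
    also have "(x + L - 1 - n) + (1 + n) = x + L" using n by simp
    finally have "next_particle L \<eta> s = x" using assms by simp
    then show False
      using next_particle_in_particles[OF s(1)] assms by (simp add: particles_def)
  qed
  then show ?thesis by (simp add: rate_left_def)
qed

lemma sum_rate_right:
  "(\<Sum>x<L. rate_right L w \<eta> x) = (\<Sum>x\<in>particles L \<eta>. w (headway L \<eta> x))"
proof -
  have "(\<Sum>x<L. rate_right L w \<eta> x) = (\<Sum>x\<in>particles L \<eta>. rate_right L w \<eta> x)"
    by (intro sum.mono_neutral_right) (auto simp: particles_def rate_right_vacant)
  then show ?thesis by (simp add: rate_right_particle)
qed

text \<open>Each gap is counted at its right end here. The successor map permutes the particles, so
  recounting at left ends gives the same total as for the right rates.\<close>

lemma sum_rate_left:
  "(\<Sum>x<L. rate_left L w \<eta> x) = (\<Sum>x\<in>particles L \<eta>. w (headway L \<eta> x))"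
proof -
  have "(\<Sum>x<L. rate_left L w \<eta> x) = (\<Sum>x\<in>particles L \<eta>. rate_left L w \<eta> x)"
    by (intro sum.mono_neutral_right) (auto simp: particles_def rate_left_vacant)
  also have "\<dots> = (\<Sum>x\<in>next_particle L \<eta> ` particles L \<eta>. rate_left L w \<eta> x)"
    by (simp add: next_particle_image)
  also have "\<dots> = (\<Sum>x\<in>particles L \<eta>. w (headway L \<eta> x))"
    by (simp add: sum.reindex[OF inj_on_next_particle] rate_left_next_particle)
  finally show ?thesis .
qed

lemma headway_weight_particles:
  "headway_weight J L \<eta> = (\<Prod>x\<in>particles L \<eta>. boltzmann_factor J (headway L \<eta> x + 1))"
proof -
  have "(\<Prod>n<L. boltzmann_factor J (n + 1) ^ headway_ind L \<eta> x n) =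
      (if x \<in> particles L \<eta> then boltzmann_factor J (headway L \<eta> x + 1) else 1)"
    if "x < L" for x
  proof (cases "x \<in> particles L \<eta>")
    case True
    then have "(\<Prod>n<L. boltzmann_factor J (n + 1) ^ headway_ind L \<eta> x n) =
        (\<Prod>n<L. if n = headway L \<eta> x then boltzmann_factor J (n + 1) else 1)"
      by (intro prod.cong) (auto simp: headway_ind_def particles_def)
    then show ?thesis using True headway_less[OF True] by simp
  next
    case False
    then show ?thesis using that by (simp add: headway_ind_def particles_def)
  qed
  then have "headway_weight J L \<eta> =
      (\<Prod>x<L. if x \<in> particles L \<eta> then boltzmann_factor J (headway L \<eta> x + 1) else 1)"
    unfolding headway_weight_def by (intro prod.cong) auto
  also have "\<dots> = (\<Prod>x\<in>particles L \<eta>. boltzmann_factor J (headway L \<eta> x + 1))"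
    by (intro prod.mono_neutral_cong_right) (auto simp: particles_def)
  finally show ?thesis .
qed

section \<open>Effect of a single jump on the headways, and detailed balance\<close>

text \<open>A particle that is its own successor has a gap winding exactly once around the torus:
  \<open>L\<close> divides the headway plus one, and the headway is below \<open>L\<close>.\<close>

lemma headway_of_single_particle:
  assumes x: "x \<in> particles L \<eta>" and next_eq: "next_particle L \<eta> x = x"
  shows "headway L \<eta> x = L - 1"
proof -
  have "((headway L \<eta> x + 1) + x) mod L = (0 + x) mod L"
    using assms by (simp add: next_particle_def particles_def add_ac)
  then have "(headway L \<eta> x + 1) mod L = 0 mod L" by (rule add_right_cancel_mod)
  then have "L dvd headway L \<eta> x + 1" by (simp add: dvd_eq_mod_eq_0)
  then have "L \<le> headway L \<eta> x + 1" by (rule dvd_imp_le) simp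
  then show ?thesis using headway_less[OF x] by linarith
qed

lemma particles_of_single_particle:
  assumes x: "x \<in> particles L \<eta>" and next_eq: "next_particle L \<eta> x = x"
  shows "particles L \<eta> = {x}"
proof -
  have "q = x" if q: "q \<in> particles L \<eta>" for q
  proof (rule ccontr)
    assume "q \<noteq> x"
    have L: "x < L" "q < L" using x q by (auto simp: particles_def)
    \<comment> \<open>The offset of \<open>q\<close> counted from \<open>x + 1\<close>. Every site
      other than \<open>x\<close> has offset below \<open>L - 1\<close>, hence lies in the empty
      stretch.\<close>
    define j where "j = (q + L - 1 - x) mod L"
    have "(x + 1 + j) mod L = (x + 1 + (q + L - 1 - x)) mod L"
      unfolding j_def by (rule mod_add_right_eq)
    also have "x + 1 + (q + L - 1 - x) = q + L" using L by simp
    finally have site: "(x + 1 + j) mod L = q" using L by simp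
    have "j < L" using L by (simp add: j_def)
    moreover have "j \<noteq> L - 1"
    proof
      assume "j = L - 1"
      then have "x + 1 + j = x + L" using L by simp
      then have "(x + 1 + j) mod L = x" using L by (simp only: mod_add_self2 mod_less)
      then show False using site \<open>q \<noteq> x\<close> by simp
    qed
    ultimately have "j < headway L \<eta> x"
      using headway_of_single_particle[OF assms] by linarith
    then show False
      using not_occupied_before_headway[of j L \<eta> x] site q by (simp add: particles_def)
  qed
  then show ?thesis using x by blast
qed

lemma exchange_exchange: "exchange (exchange \<eta> x y) x y = \<eta>"
  by (auto simp: exchange_def fun_eq_iff)

lemma exchange_commute: "exchange \<eta> x y = exchange \<eta> y x"
  by (auto simp: exchange_def fun_eq_iff)

lemma num_particles_exchange:
  assumes "x < L" "y < L"
  shows "num_particles L (exchange \<eta> x y) = num_particles L \<eta>"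
proof (cases "x = y")
  case True
  then show ?thesis by (simp add: exchange_def)
next
  case False
  have split: "num_particles L f = f x + (f y + (\<Sum>i\<in>{..<L} - {x} - {y}. f i))" for f
    unfolding num_particles_def using assms False
    by (simp add: sum.remove[of "{..<L}" x] sum.remove[of "{..<L} - {x}" y])
  show ?thesis
    unfolding split using False by (simp add: exchange_def)
qed

text \<open>A jump moves the boundary between two gaps: the one in front of the jumping particle
  shrinks, the one in front of its predecessor \<open>p\<close> grows. The condition
  \<open>p \<noteq> x\<close> makes these two different gaps; the single particle is treated
  separately.\<close>

lemma headway_exchange_next:
  assumes x: "x \<in> particles L \<eta>" and x': "x' = (x + 1) mod L" and vac: "\<eta> x' = 0"
    and p: "p \<in> particles L \<eta>" and px: "next_particle L \<eta> p = x" and "p \<noteq> x"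
  defines "\<xi> \<equiv> exchange \<eta> x x'"
  shows "0 < headway L \<eta> x"
    and "headway L \<xi> x' = headway L \<eta> x - 1"
    and "headway L \<xi> p = headway L \<eta> p + 1"
    and "\<And>q. q \<in> particles L \<eta> \<Longrightarrow> q \<noteq> p \<Longrightarrow> q \<noteq> x \<Longrightarrow> headway L \<xi> q = headway L \<eta> q"
proof -
  have L: "x < L" "x' < L" using x x' by (auto simp: particles_def)
  have occ: "\<eta> x = 1" using x by (simp add: particles_def)
  have "x \<noteq> x'" using occ vac by auto
  have \<xi>: "\<xi> i = (if i = x then 0 else if i = x' then 1 else \<eta> i)" for i
    using occ vac \<open>x \<noteq> x'\<close> by (simp add: \<xi>_def exchange_def)
  let ?n = "headway L \<eta> x" and ?m = "headway L \<eta> p"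
  show n: "0 < ?n"
  proof (rule ccontr)
    assume "\<not> 0 < ?n"
    then have "next_particle L \<eta> x = x'" by (simp add: next_particle_def x')
    then show False using next_particle_in_particles[OF x] vac by (simp add: particles_def)
  qed
  have shift: "(x' + 1 + j) mod L = (x + 1 + (j + 1)) mod L" for j
    unfolding x' by (metis (no_types, lifting) add.assoc add.commute mod_add_left_eq)
  have pred_of_x': "(q + i) mod L = x" if "(q + 1 + i) mod L = x'" for q i
  proof -
    have "((q + i) + 1) mod L = (x + 1) mod L" using that x' by (simp add: add_ac)
    then have "(q + i) mod L = x mod L" by (rule add_right_cancel_mod)
    then show ?thesis using L by simp
  qed
  \<comment> \<open>A scan starting at \<open>q\<close> can reach \<open>x'\<close> only through
    \<open>x\<close>, where the particle at \<open>x\<close> would already have stopped it.\<close>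
  have avoid_x': "(q + 1 + j) mod L \<noteq> x'"
    if q: "q \<in> particles L \<eta>" "q \<noteq> x" and j: "j \<le> headway L \<eta> q" for q j
  proof
    assume "(q + 1 + j) mod L = x'"
    then have qj: "(q + j) mod L = x" by (rule pred_of_x')
    show False
    proof (cases j)
      case 0
      then show False using qj q by (simp add: particles_def)
    next
      case (Suc i)
      then show False
        using qj j occ not_occupied_before_headway[of i L \<eta> q] by simp
    qed
  qed
  \<comment> \<open>The particle that ends the gap in front of \<open>x\<close> is thus not the one
    that moves, and it still ends the gap after the jump.\<close>
  have next_x: "next_particle L \<eta> x \<noteq> x"
    using inj_onD[OF inj_on_next_particle _ p x] px \<open>p \<noteq> x\<close> by auto
  show "headway L \<xi> x' = ?n - 1"
  proof (rule headway_eqI)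
    have "(x' + 1 + (?n - 1)) mod L = next_particle L \<eta> x"
      unfolding shift next_particle_def using n by simp
    then show "\<xi> ((x' + 1 + (?n - 1)) mod L) = 1"
      using next_x next_particle_in_particles[OF x] by (simp add: \<xi> particles_def)
    fix j assume j: "j < ?n - 1"
    then have "\<eta> ((x' + 1 + j) mod L) \<noteq> 1"
      unfolding shift by (intro not_occupied_before_headway) simp
    \<comment> \<open>The only newly occupied site is \<open>x'\<close> itself, and the scan is too
      short to wind around to it.\<close>
    moreover have "(x' + 1 + j) mod L \<noteq> x'"
    proof
      assume "(x' + 1 + j) mod L = x'"
      then have "((j + 1) + x') mod L = (0 + x') mod L" using L by (simp add: add_ac)
      then have "(j + 1) mod L = 0 mod L" by (rule add_right_cancel_mod)
      moreover have "j + 1 < L" using j headway_less[OF x] by simp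
      ultimately show False by simp
    qed
    ultimately show "\<xi> ((x' + 1 + j) mod L) \<noteq> 1" by (simp add: \<xi>)
  qed
  show "headway L \<xi> p = ?m + 1"
  proof (rule headway_eqI)
    have "(p + 1 + (?m + 1)) mod L = (next_particle L \<eta> p + 1) mod L"
      unfolding next_particle_def by (simp add: mod_Suc_eq)
    then show "\<xi> ((p + 1 + (?m + 1)) mod L) = 1"
      using px x' \<open>x \<noteq> x'\<close> by (simp add: \<xi>)
    fix j assume "j < ?m + 1"
    then consider "j < ?m" | "j = ?m" by linarith
    then show "\<xi> ((p + 1 + j) mod L) \<noteq> 1"
    proof cases
      case 1
      then show ?thesis
        using avoid_x'[OF p \<open>p \<noteq> x\<close>, of j] not_occupied_before_headway[of j L \<eta> p]
        by (simp add: \<xi>)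
    next
      case 2
      then show ?thesis using px by (simp add: \<xi> next_particle_def)
    qed
  qed
  show "headway L \<xi> q = headway L \<eta> q" if q: "q \<in> particles L \<eta>" "q \<noteq> p" "q \<noteq> x" for q
  proof (rule headway_eqI)
    have "next_particle L \<eta> q \<noteq> x"
      using inj_onD[OF inj_on_next_particle _ p q(1)] px q(2) by auto
    then show "\<xi> ((q + 1 + headway L \<eta> q) mod L) = 1"
      using avoid_x'[OF q(1,3), of "headway L \<eta> q"] next_particle_in_particles[OF q(1)]
      by (simp add: \<xi> next_particle_def particles_def)
    fix j assume "j < headway L \<eta> q"
    then show "\<xi> ((q + 1 + j) mod L) \<noteq> 1"
      using avoid_x'[OF q(1,3), of j] not_occupied_before_headway[of j L \<eta> q] by (simp add: \<xi>)
  qed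
qed

text \<open>Both sides vanish when \<open>x\<close> is vacant or the jump is blocked, the latter
  because \<open>w 0 = 0\<close>. Otherwise all factors of the weight cancel except those of the two
  gaps adjacent to the moving particle.\<close>

lemma detailed_balance:
  assumes \<eta>: "\<eta> \<in> Omega_gc L" and xL: "x < L" and w0: "w 0 = 0"
    and wy: "\<And>n. w n * boltzmann_factor J (n + 1) = c * boltzmann_factor J n"
  defines "\<xi> \<equiv> exchange \<eta> x ((x + 1) mod L)"
  shows "headway_weight J L \<eta> * rate_right L w \<eta> x =
         headway_weight J L \<xi> * rate_left L w \<xi> ((x + 1) mod L)"
proof -
  define x' where "x' = (x + 1) mod L"
  have x'L: "x' < L" using xL by (simp add: x'_def)
  have \<xi>: "\<xi> = exchange \<eta> x x'" by (simp add: \<xi>_def x'_def)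
  consider (vacant) "\<eta> x \<noteq> 1" | (blocked) "\<eta> x = 1" "\<eta> x' = 1" | (free) "\<eta> x = 1" "\<eta> x' = 0"
    using PiE_mem[of \<eta> "{..<L}" "\<lambda>_. {0, 1}" x'] \<eta> x'L by (auto simp: Omega_gc_def)
  then show ?thesis unfolding x'_def[symmetric]
  proof cases
    case vacant
    have "\<xi> x' \<noteq> 1" using vacant by (simp add: \<xi> exchange_def)
    then show "headway_weight J L \<eta> * rate_right L w \<eta> x = headway_weight J L \<xi> * rate_left L w \<xi> x'"
      using vacant x'L by (simp add: rate_right_vacant rate_left_vacant)
  next
    case blocked
    have "\<xi> = \<eta>" using blocked by (auto simp: \<xi> exchange_def fun_eq_iff)
    moreover have x: "x \<in> particles L \<eta>" using blocked xL by (simp add: particles_def)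
    moreover have h: "headway L \<eta> x = 0"
      by (rule headway_eqI) (use blocked in \<open>auto simp: x'_def\<close>)
    moreover have "next_particle L \<eta> x = x'" by (simp add: next_particle_def h x'_def)
    ultimately show "headway_weight J L \<eta> * rate_right L w \<eta> x = headway_weight J L \<xi> * rate_left L w \<xi> x'"
      using rate_right_particle[OF x] rate_left_next_particle[OF x] w0 by (metis mult_zero_right)
  next
    case free
    have x: "x \<in> particles L \<eta>" using free xL by (simp add: particles_def)
    have "x \<noteq> x'" using free by auto
    have P\<xi>: "particles L \<xi> = insert x' (particles L \<eta> - {x})"
      using free xL x'L \<open>x \<noteq> x'\<close> by (auto simp: particles_def \<xi> exchange_def)
    obtain p where p: "p \<in> particles L \<eta>" and px: "next_particle L \<eta> p = x"
      using next_particle_image[of L \<eta>] x by (metis imageE)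
    show "headway_weight J L \<eta> * rate_right L w \<eta> x = headway_weight J L \<xi> * rate_left L w \<xi> x'"
    proof (cases "p = x")
      \<comment> \<open>A lone particle has headway \<open>L - 1\<close> before and after the jump,
        so the weights agree and so do the rates.\<close>
      case True
      then have P: "particles L \<eta> = {x}" and h: "headway L \<eta> x = L - 1"
        using particles_of_single_particle headway_of_single_particle p px by blast+
      have P': "particles L \<xi> = {x'}" using P P\<xi> by simp
      then have x'P: "x' \<in> particles L \<xi>" by simp
      have nx: "next_particle L \<xi> x' = x'"
        using next_particle_in_particles[OF x'P] P' by simp
      have "headway L \<xi> x' = L - 1"
        by (rule headway_of_single_particle[OF x'P nx])
      then show ?thesis
        using rate_right_particle[OF x, of w] rate_left_next_particle[OF x'P, of w] h P P' nx
        by (simp add: headway_weight_particles)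
    next
      case False
      note hw = headway_exchange_next[OF x x'_def free(2) p px False, folded \<xi>]
      define n m R where "n = headway L \<eta> x" and "m = headway L \<eta> p"
        and "R = (\<Prod>q\<in>particles L \<eta> - {x} - {p}. boltzmann_factor J (headway L \<eta> q + 1))"
      have x'_notin: "x' \<notin> particles L \<eta>" using free by (simp add: particles_def)
      have W\<eta>: "headway_weight J L \<eta> = boltzmann_factor J (n + 1) * (boltzmann_factor J (m + 1) * R)"
        using x p False finite_particles[of L \<eta>]
        by (simp add: headway_weight_particles prod.remove[of _ x] prod.remove[of _ p] R_def n_def m_def)
      have "headway_weight J L \<xi> = boltzmann_factor J (headway L \<xi> x' + 1) *
          (\<Prod>q\<in>particles L \<eta> - {x}. boltzmann_factor J (headway L \<xi> q + 1))"
        unfolding headway_weight_particles P\<xi> using finite_particles[of L \<eta>] x'_notin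
        by (simp add: prod.insert)
      also have "(\<Prod>q\<in>particles L \<eta> - {x}. boltzmann_factor J (headway L \<xi> q + 1)) =
          boltzmann_factor J (m + 2) *
          (\<Prod>q\<in>particles L \<eta> - {x} - {p}. boltzmann_factor J (headway L \<xi> q + 1))"
        using p False finite_particles[of L \<eta>] hw(3)
        by (simp add: prod.remove[of _ p] m_def)
      also have "(\<Prod>q\<in>particles L \<eta> - {x} - {p}. boltzmann_factor J (headway L \<xi> q + 1)) = R"
        unfolding R_def using hw(4) by (intro prod.cong) auto
      also have "headway L \<xi> x' + 1 = n" using hw(1,2) by (simp add: n_def)
      finally have W\<xi>: "headway_weight J L \<xi> = boltzmann_factor J n * (boltzmann_factor J (m + 2) * R)" .
      have p\<xi>: "p \<in> particles L \<xi>" using p False P\<xi> by simp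
      have "next_particle L \<xi> p = (next_particle L \<eta> p + 1) mod L"
        unfolding next_particle_def hw(3) by (simp add: mod_Suc_eq)
      then have "next_particle L \<xi> p = x'" by (simp add: px x'_def)
      then have "rate_left L w \<xi> x' = w (m + 1)"
        using rate_left_next_particle[OF p\<xi>, of w] hw(3) by (simp add: m_def)
      moreover have "rate_right L w \<eta> x = w n"
        using rate_right_particle[OF x, of w] by (simp add: n_def)
      moreover have "boltzmann_factor J (n + 1) * (boltzmann_factor J (m + 1) * R) * w n =
          boltzmann_factor J n * (boltzmann_factor J (m + 2) * R) * w (m + 1)"
      proof -
        \<comment> \<open>The relation \<open>wy\<close> is applied forwards at \<open>n\<close> and
          backwards at \<open>m + 1\<close>; the steps match because \<open>c\<close> does not
          depend on the headway.\<close>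
        have "boltzmann_factor J (n + 1) * (boltzmann_factor J (m + 1) * R) * w n =
            (w n * boltzmann_factor J (n + 1)) * boltzmann_factor J (m + 1) * R" by simp
        also have "\<dots> = (c * boltzmann_factor J (m + 1)) * boltzmann_factor J n * R"
          unfolding wy by simp
        also have "\<dots> = (w (m + 1) * boltzmann_factor J (m + 2)) * boltzmann_factor J n * R"
          using wy[of "m + 1"] by simp
        finally show ?thesis by (simp only: mult_ac)
      qed
      ultimately show ?thesis unfolding W\<eta> W\<xi> by simp
    qed
  qed
qed


section \<open>From detailed balance to stationarity for the generator\<close>

lemma bij_betw_succ_mod:
  fixes L :: nat
  shows "bij_betw (\<lambda>x. (x + 1) mod L) {..<L} {..<L}"
proof -
  have inj: "inj_on (\<lambda>x. (x + 1) mod L) {..<L}"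
  proof (rule inj_onI)
    fix x y assume xy: "x \<in> {..<L}" "y \<in> {..<L}" "(x + 1) mod L = (y + 1) mod L"
    have "x mod L = y mod L" using xy(3) by (rule add_right_cancel_mod)
    then show "x = y" using xy by simp
  qed
  moreover have "(\<lambda>x. (x + 1) mod L) ` {..<L} = {..<L}"
    by (rule endo_inj_surj[OF _ _ inj]) auto
  ultimately show ?thesis by (simp add: bij_betw_def)
qed

lemma pred_succ_mod:
  assumes "x < L"
  shows "((x + 1) mod L + L - 1) mod L = (x::nat)"
proof (cases "x + 1 = L")
  case True
  then show ?thesis by auto
qed (use assms in simp)

text \<open>Gain and loss are separated. The total rates in the two directions are the same sum over
  headways, so the loss depends on \<open>r\<close> and \<open>l\<close> only through
  \<open>r + l\<close>.\<close>

lemma hep_generator_expand: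
  "hep_generator r l w L f \<eta> =
     r * (\<Sum>x<L. rate_right L w \<eta> x * f (exchange \<eta> x ((x + 1) mod L)))
   + l * (\<Sum>x<L. rate_left L w \<eta> x * f (exchange \<eta> x ((x + L - 1) mod L)))
   - (r + l) * (\<Sum>x\<in>particles L \<eta>. w (headway L \<eta> x)) * f \<eta>"
proof -
  have "hep_generator r l w L f \<eta> =
      r * (\<Sum>x<L. rate_right L w \<eta> x * f (exchange \<eta> x ((x + 1) mod L)))
    + l * (\<Sum>x<L. rate_left L w \<eta> x * f (exchange \<eta> x ((x + L - 1) mod L)))
    - (r * (\<Sum>x<L. rate_right L w \<eta> x) + l * (\<Sum>x<L. rate_left L w \<eta> x)) * f \<eta>"
    unfolding hep_generator_def
    by (simp add: sum_distrib_left sum_distrib_right sum.distrib sum_subtractf algebra_simps)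
  then show ?thesis
    unfolding sum_rate_right sum_rate_left by (simp add: algebra_simps)
qed

lemma sum_exchange:
  assumes "x < L" "y < L" "\<And>\<eta> x y. \<eta> \<in> S \<Longrightarrow> x < L \<Longrightarrow> y < L \<Longrightarrow> exchange \<eta> x y \<in> S"
  shows "(\<Sum>\<eta>\<in>S. g (exchange \<eta> x y)) = (\<Sum>\<eta>\<in>S. g \<eta>)"
  by (rule sum.reindex_bij_witness[where i = "\<lambda>\<eta>. exchange \<eta> x y" and j = "\<lambda>\<eta>. exchange \<eta> x y"])
     (use assms in \<open>auto simp: exchange_exchange\<close>)

text \<open>
  Detailed balance pairs every right jump with the reverse left jump, so the inflow into a
  configuration by right jumps is its total left-jump rate, and conversely.  The total rates
  to the right and to the left agree.
\<close>

lemma sum_generator_eq_0: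
  assumes closed: "\<And>\<eta> x y. \<eta> \<in> S \<Longrightarrow> x < L \<Longrightarrow> y < L \<Longrightarrow> exchange \<eta> x y \<in> S"
    and db: "\<And>\<eta> x. \<eta> \<in> S \<Longrightarrow> x < L \<Longrightarrow> \<nu> \<eta> * rate_right L w \<eta> x =
          \<nu> (exchange \<eta> x ((x + 1) mod L)) *
          rate_left L w (exchange \<eta> x ((x + 1) mod L)) ((x + 1) mod L)"
  shows "(\<Sum>\<eta>\<in>S. \<nu> \<eta> * hep_generator r l w L f \<eta>) = 0"
proof -
  let ?s = "\<lambda>x. (x + 1) mod L"
  let ?C = "\<lambda>\<eta>. \<Sum>x\<in>particles L \<eta>. w (headway L \<eta> x)"
  have right: "(\<Sum>\<eta>\<in>S. \<nu> \<eta> * (rate_right L w \<eta> x * f (exchange \<eta> x (?s x)))) =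
      (\<Sum>\<eta>\<in>S. \<nu> \<eta> * (rate_left L w \<eta> (?s x) * f \<eta>))" if x: "x < L" for x
  proof -
    have "(\<Sum>\<eta>\<in>S. \<nu> \<eta> * (rate_right L w \<eta> x * f (exchange \<eta> x (?s x)))) =
        (\<Sum>\<eta>\<in>S. (\<lambda>\<xi>. \<nu> \<xi> * (rate_left L w \<xi> (?s x) * f \<xi>)) (exchange \<eta> x (?s x)))"
      using db x by (intro sum.cong) (simp_all add: mult.assoc[symmetric])
    also have "\<dots> = (\<Sum>\<eta>\<in>S. \<nu> \<eta> * (rate_left L w \<eta> (?s x) * f \<eta>))"
      by (rule sum_exchange) (use x closed in auto)
    finally show ?thesis .
  qed
  have left: "(\<Sum>\<eta>\<in>S. \<nu> \<eta> * (rate_left L w \<eta> (?s x) * f (exchange \<eta> (?s x) x))) =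
      (\<Sum>\<eta>\<in>S. \<nu> \<eta> * (rate_right L w \<eta> x * f \<eta>))" if x: "x < L" for x
  proof -
    have "(\<Sum>\<eta>\<in>S. \<nu> \<eta> * (rate_right L w \<eta> x * f \<eta>)) =
        (\<Sum>\<eta>\<in>S. (\<lambda>\<xi>. \<nu> \<xi> * (rate_left L w \<xi> (?s x) * f (exchange \<xi> (?s x) x))) (exchange \<eta> x (?s x)))"
    proof (intro sum.cong refl)
      fix \<eta> assume \<eta>: "\<eta> \<in> S"
      have "exchange (exchange \<eta> x (?s x)) (?s x) x = \<eta>"
        by (metis exchange_commute exchange_exchange)
      then show "\<nu> \<eta> * (rate_right L w \<eta> x * f \<eta>) =
          (\<lambda>\<xi>. \<nu> \<xi> * (rate_left L w \<xi> (?s x) * f (exchange \<xi> (?s x) x))) (exchange \<eta> x (?s x))"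
        using db[OF \<eta> x] by (simp add: mult.assoc[symmetric])
    qed
    also have "\<dots> = (\<Sum>\<eta>\<in>S. \<nu> \<eta> * (rate_left L w \<eta> (?s x) * f (exchange \<eta> (?s x) x)))"
      by (rule sum_exchange) (use x closed in auto)
    finally show ?thesis by simp
  qed
  \<comment> \<open>Detailed balance attaches a left jump to the bond between \<open>x\<close> and
    \<open>x + 1\<close>, whereas the generator indexes it by its starting site
    \<open>x + 1\<close>.\<close>
  have reindex: "(\<Sum>x<L. g (?s x)) = (\<Sum>x<L. g x)" for g :: "nat \<Rightarrow> real"
    by (rule sum.reindex_bij_betw[OF bij_betw_succ_mod])
  have inflow_right: "(\<Sum>\<eta>\<in>S. \<nu> \<eta> * (\<Sum>x<L. rate_right L w \<eta> x * f (exchange \<eta> x (?s x)))) =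
      (\<Sum>\<eta>\<in>S. \<nu> \<eta> * (?C \<eta> * f \<eta>))"
  proof -
    have "(\<Sum>\<eta>\<in>S. \<nu> \<eta> * (\<Sum>x<L. rate_right L w \<eta> x * f (exchange \<eta> x (?s x)))) =
        (\<Sum>x<L. \<Sum>\<eta>\<in>S. \<nu> \<eta> * (rate_right L w \<eta> x * f (exchange \<eta> x (?s x))))"
      unfolding sum_distrib_left by (rule sum.swap)
    also have "\<dots> = (\<Sum>x<L. \<Sum>\<eta>\<in>S. \<nu> \<eta> * (rate_left L w \<eta> (?s x) * f \<eta>))"
      by (intro sum.cong refl right) simp
    also have "\<dots> = (\<Sum>\<eta>\<in>S. \<Sum>x<L. \<nu> \<eta> * (rate_left L w \<eta> (?s x) * f \<eta>))"
      by (rule sum.swap)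
    also have "\<dots> = (\<Sum>\<eta>\<in>S. \<nu> \<eta> * ((\<Sum>x<L. rate_left L w \<eta> (?s x)) * f \<eta>))"
      by (simp only: sum_distrib_left sum_distrib_right)
    finally show ?thesis by (simp only: reindex sum_rate_left)
  qed
  have inflow_left:
    "(\<Sum>\<eta>\<in>S. \<nu> \<eta> * (\<Sum>x<L. rate_left L w \<eta> x * f (exchange \<eta> x ((x + L - 1) mod L)))) =
      (\<Sum>\<eta>\<in>S. \<nu> \<eta> * (?C \<eta> * f \<eta>))"
  proof -
    have "(\<Sum>\<eta>\<in>S. \<nu> \<eta> * (\<Sum>x<L. rate_left L w \<eta> x * f (exchange \<eta> x ((x + L - 1) mod L)))) =
        (\<Sum>\<eta>\<in>S. \<nu> \<eta> * (\<Sum>x<L. rate_left L w \<eta> (?s x) * f (exchange \<eta> (?s x) ((?s x + L - 1) mod L))))"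
      by (simp only: reindex[of "\<lambda>x. rate_left L w \<eta> x * f (exchange \<eta> x ((x + L - 1) mod L))" for \<eta>])
    also have "\<dots> = (\<Sum>\<eta>\<in>S. \<nu> \<eta> * (\<Sum>x<L. rate_left L w \<eta> (?s x) * f (exchange \<eta> (?s x) x)))"
      by (intro sum.cong refl arg_cong2[where f = "(*)"]) (simp only: lessThan_iff pred_succ_mod)
    also have "\<dots> = (\<Sum>x<L. \<Sum>\<eta>\<in>S. \<nu> \<eta> * (rate_left L w \<eta> (?s x) * f (exchange \<eta> (?s x) x)))"
      unfolding sum_distrib_left by (rule sum.swap)
    also have "\<dots> = (\<Sum>x<L. \<Sum>\<eta>\<in>S. \<nu> \<eta> * (rate_right L w \<eta> x * f \<eta>))"
      by (intro sum.cong refl left) simp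
    also have "\<dots> = (\<Sum>\<eta>\<in>S. \<Sum>x<L. \<nu> \<eta> * (rate_right L w \<eta> x * f \<eta>))"
      by (rule sum.swap)
    also have "\<dots> = (\<Sum>\<eta>\<in>S. \<nu> \<eta> * ((\<Sum>x<L. rate_right L w \<eta> x) * f \<eta>))"
      by (simp only: sum_distrib_left sum_distrib_right)
    finally show ?thesis by (simp only: sum_rate_right)
  qed
  have split: "v * (r * a + l * b - (r + l) * k * g) = r * (v * a) + l * (v * b) - (r + l) * (v * (k * g))"
    for v a b k g :: real
    by (simp add: algebra_simps)
  have "(\<Sum>\<eta>\<in>S. \<nu> \<eta> * hep_generator r l w L f \<eta>) =
      r * (\<Sum>\<eta>\<in>S. \<nu> \<eta> * (\<Sum>x<L. rate_right L w \<eta> x * f (exchange \<eta> x (?s x))))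
    + l * (\<Sum>\<eta>\<in>S. \<nu> \<eta> * (\<Sum>x<L. rate_left L w \<eta> x * f (exchange \<eta> x ((x + L - 1) mod L))))
    - (r + l) * (\<Sum>\<eta>\<in>S. \<nu> \<eta> * (?C \<eta> * f \<eta>))"
    unfolding hep_generator_expand split
    by (simp only: sum_subtractf sum.distrib sum_distrib_left[symmetric])
  then show ?thesis
    unfolding inflow_right inflow_left by (simp add: algebra_simps)
qed

section \<open>Invariance under the semigroup versus stationarity for the generator\<close>

lemma semigroup_sums:
  assumes "S \<subseteq> Omega_gc L"
  shows "(\<lambda>k. (\<Sum>\<eta>\<in>S. \<mu> \<eta> * (hep_generator r l w L ^^ k) f \<eta>) / fact k * t ^ k)
         sums (\<Sum>\<eta>\<in>S. \<mu> \<eta> * hep_semigroup r l w L t f \<eta>)"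
proof -
  have "(\<lambda>k. \<Sum>\<eta>\<in>S. \<mu> \<eta> * (t ^ k / fact k * (hep_generator r l w L ^^ k) f \<eta>))
        sums (\<Sum>\<eta>\<in>S. \<mu> \<eta> * hep_semigroup r l w L t f \<eta>)"
    unfolding hep_semigroup_def using assms
    by (intro sums_sum sums_mult summable_sums summable_hep_semigroup) auto
  then show ?thesis
    by (simp add: sum_distrib_left sum_distrib_right sum_divide_distrib mult_ac)
qed

text \<open>The expectation at time \<open>t\<close> is a power series in \<open>t\<close> whose
  linear coefficient is the sum involving the generator. If that sum vanishes for every function,
  all higher coefficients vanish too. Conversely, a series that is constant for
  \<open>t \<ge> 0\<close> has linear coefficient zero.\<close>

lemma hep_invariant_on_iff:
  assumes S: "S \<subseteq> Omega_gc L"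
  shows "hep_invariant_on r l w L S \<mu> \<longleftrightarrow>
         (\<forall>f. (\<Sum>\<eta>\<in>S. \<mu> \<eta> * hep_generator r l w L f \<eta>) = 0)"
proof
  assume gen: "\<forall>f. (\<Sum>\<eta>\<in>S. \<mu> \<eta> * hep_generator r l w L f \<eta>) = 0"
  show "hep_invariant_on r l w L S \<mu>"
    unfolding hep_invariant_on_def
  proof (intro allI impI)
    fix t :: real and f
    have "(\<lambda>k. (\<Sum>\<eta>\<in>S. \<mu> \<eta> * (hep_generator r l w L ^^ k) f \<eta>) / fact k * t ^ k)
        = (\<lambda>k. if k = 0 then \<Sum>\<eta>\<in>S. \<mu> \<eta> * f \<eta> else 0)"
    proof
      fix k
      show "(\<Sum>\<eta>\<in>S. \<mu> \<eta> * (hep_generator r l w L ^^ k) f \<eta>) / fact k * t ^ k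
          = (if k = 0 then \<Sum>\<eta>\<in>S. \<mu> \<eta> * f \<eta> else 0)"
        \<comment> \<open>For a successor \<open>k\<close>, the hypothesis is applied to an iterate
          of the generator on \<open>f\<close>.\<close>
        by (cases k) (use gen in simp_all)
    qed
    then show "(\<Sum>\<eta>\<in>S. \<mu> \<eta> * hep_semigroup r l w L t f \<eta>) = (\<Sum>\<eta>\<in>S. \<mu> \<eta> * f \<eta>)"
      using semigroup_sums[OF S, of \<mu> r l w f t] sums_single[of 0 "\<lambda>_. \<Sum>\<eta>\<in>S. \<mu> \<eta> * f \<eta>"]
      by (simp add: sums_unique2)
  qed
next
  assume inv: "hep_invariant_on r l w L S \<mu>"
  show "\<forall>f. (\<Sum>\<eta>\<in>S. \<mu> \<eta> * hep_generator r l w L f \<eta>) = 0"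
  proof
    fix f
    define a where "a k = (\<Sum>\<eta>\<in>S. \<mu> \<eta> * (hep_generator r l w L ^^ k) f \<eta>) / fact k" for k
    have a: "(\<lambda>k. a k * t ^ k) sums (\<Sum>\<eta>\<in>S. \<mu> \<eta> * hep_semigroup r l w L t f \<eta>)" for t
      unfolding a_def by (rule semigroup_sums[OF S])
    \<comment> \<open>The difference quotient of the series at 0, with its value at 0 filled in by
      the linear coefficient.\<close>
    define g where "g t = (\<Sum>k. a (Suc k) * t ^ k)" for t
    have g: "(\<lambda>k. a (Suc k) * t ^ k) sums g t" for t
      unfolding g_def using sums_summable[OF a[of t]] by (intro summable_sums powser_split_head(3))
    have "g t = 0" if t: "0 < t" for t
    proof -
      have "(\<Sum>k. a k * t ^ k) = a 0"
        using sums_unique[OF a[of t]] inv t by (simp add: hep_invariant_on_def a_def)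
      then have "g t * t = 0"
        using powser_split_head(1)[OF sums_summable[OF a[of t]]] by (simp add: g_def)
      then show ?thesis using t by simp
    qed
    \<comment> \<open>Invariance speaks only of nonnegative times, so the coefficient is recovered
      as a limit from the right.\<close>
    then have "eventually (\<lambda>t. 0 = g t) (at_right 0)"
      unfolding eventually_at_right_field by (intro exI[of _ 1]) auto
    then have "(g \<longlongrightarrow> 0) (at_right 0)"
      by (rule Lim_transform_eventually[OF tendsto_const])
    moreover have "(g \<longlongrightarrow> a (Suc 0)) (at_right 0)"
      by (rule tendsto_mono[OF at_le powser_limit_0[of 1 "\<lambda>k. a (Suc k)"]]) (use g in auto)
    ultimately have "a (Suc 0) = 0"
      by (intro tendsto_unique[of "at_right 0" g]) simp_all
    then show "(\<Sum>\<eta>\<in>S. \<mu> \<eta> * hep_generator r l w L f \<eta>) = 0"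
      by (simp add: a_def)
  qed
qed

section \<open>Invariance of the headway measure for rates given by the potential\<close>

text \<open>For \<open>n = 0\<close> both sides are zero by the conventions for \<open>w 0\<close>
  and \<open>boltzmann_factor J 0\<close>. For larger \<open>n\<close>, finiteness of
  \<open>J\<close> makes the extended-real difference an ordinary one.\<close>

lemma rates_of_potential_boltzmann_factor:
  assumes J: "interaction_potential J" "\<And>k. 1 \<le> k \<Longrightarrow> J k \<noteq> \<infinity>"
    and w: "rates_of_potential J c w"
  shows "w n * boltzmann_factor J (n + 1) = c * boltzmann_factor J n"
proof (cases "n = 0")
  case True
  then show ?thesis using w by (simp add: rates_of_potential_def boltzmann_factor_def)
next
  case False
  obtain a where a: "J n = ereal a"
    using J False by (cases "J n") (auto simp: interaction_potential_def)
  obtain b where b: "J (n + 1) = ereal b"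
    using J by (cases "J (n + 1)") (auto simp: interaction_potential_def)
  show ?thesis
    using False w a b
    by (simp add: rates_of_potential_def boltzmann_factor_def exp_add[symmetric])
qed

lemma mu_gc_detailed_balance:
  assumes J: "interaction_potential J" "\<And>k. 1 \<le> k \<Longrightarrow> J k \<noteq> \<infinity>"
    and w: "rates_of_potential J c w" and \<eta>: "\<eta> \<in> Omega_gc L" and x: "x < L"
  shows "mu_gc J L z \<eta> * rate_right L w \<eta> x =
      mu_gc J L z (exchange \<eta> x ((x + 1) mod L)) *
      rate_left L w (exchange \<eta> x ((x + 1) mod L)) ((x + 1) mod L)"
proof -
  have "w 0 = 0" using w by (simp add: rates_of_potential_def)
  then have "headway_weight J L \<eta> * rate_right L w \<eta> x =
      headway_weight J L (exchange \<eta> x ((x + 1) mod L)) *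
      rate_left L w (exchange \<eta> x ((x + 1) mod L)) ((x + 1) mod L)"
    using detailed_balance[OF \<eta> x] rates_of_potential_boltzmann_factor[OF J w] by blast
  moreover have "num_particles L (exchange \<eta> x ((x + 1) mod L)) = num_particles L \<eta>"
    using x by (intro num_particles_exchange) auto
  ultimately show ?thesis by (simp add: mu_gc_def)
qed

lemma exchange_in_Omega_can:
  "\<eta> \<in> Omega_can L N \<Longrightarrow> x < L \<Longrightarrow> y < L \<Longrightarrow> exchange \<eta> x y \<in> Omega_can L N"
  by (simp add: Omega_can_def exchange_in_Omega_gc num_particles_exchange)

lemma Omega_can_subset: "Omega_can L N \<subseteq> Omega_gc L"
  by (auto simp: Omega_can_def)

text \<open>The set \<open>S\<close> is kept general to cover both the full state space and every
  fixed particle number.\<close>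

lemma hep_invariant_on_mu_gc:
  assumes J: "interaction_potential J" "\<And>k. 1 \<le> k \<Longrightarrow> J k \<noteq> \<infinity>"
    and w: "rates_of_potential J c w" and S: "S \<subseteq> Omega_gc L"
    and closed: "\<And>\<eta> x y. \<eta> \<in> S \<Longrightarrow> x < L \<Longrightarrow> y < L \<Longrightarrow> exchange \<eta> x y \<in> S"
  shows "hep_invariant_on r l w L S (mu_gc J L z)"
  unfolding hep_invariant_on_iff[OF S]
  by (intro allI sum_generator_eq_0 closed mu_gc_detailed_balance[OF J w]) (use S in auto)

section \<open>Recovering the rates from invariance\<close>

lemma mu_gc_pos:
  assumes J: "\<And>k. 1 \<le> k \<Longrightarrow> J k \<noteq> \<infinity>" and z: "0 < z" and \<eta>: "\<eta> \<in> Omega_gc L"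
  shows "0 < mu_gc J L z \<eta>"
proof -
  have weight: "0 < z ^ num_particles L \<xi> * headway_weight J L \<xi>" for \<xi>
    using z J by (auto simp: headway_weight_def boltzmann_factor_def intro!: mult_pos_pos prod_pos)
  then have "0 < gc_partition J L z"
    unfolding gc_partition_def using \<eta> finite_Omega_gc by (intro sum_pos) auto
  then show ?thesis using weight by (simp add: mu_gc_def)
qed

lemma rate_diff:
  "rate_right L (\<lambda>n. u n - v n) \<eta> x = rate_right L u \<eta> x - rate_right L v \<eta> x"
  "rate_left L (\<lambda>n. u n - v n) \<eta> x = rate_left L u \<eta> x - rate_left L v \<eta> x"
  by (simp_all add: rate_right_def rate_left_def left_diff_distrib sum_subtractf)

text \<open>The generator is linear in the rates. A difference of rates may be negative, so the
  result need not generate a Markov chain.\<close>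

lemma hep_generator_diff:
  "hep_generator r l (\<lambda>n. u n - v n) L f \<eta> = hep_generator r l u L f \<eta> - hep_generator r l v L f \<eta>"
  unfolding hep_generator_def rate_diff sum_subtractf[symmetric]
  by (intro sum.cong refl) (simp only: ring_distribs)

text \<open>The restriction makes this an extensional function, so that it belongs to the state
  space.\<close>

definition adjacent_pair :: "nat \<Rightarrow> config" where
  "adjacent_pair L = restrict (\<lambda>i. if i \<le> 1 then 1 else 0) {..<L}"

lemma adjacent_pair_in_Omega_can:
  assumes "2 \<le> L"
  shows "adjacent_pair L \<in> Omega_can L 2"
proof -
  have "num_particles L (adjacent_pair L) = (\<Sum>i\<in>{0, 1 :: nat}. 1)"
    unfolding num_particles_def
    by (rule sum.mono_neutral_cong_right) (use assms in \<open>auto simp: adjacent_pair_def\<close>)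
  then show ?thesis by (auto simp: Omega_can_def Omega_gc_def adjacent_pair_def)
qed

lemma adjacent_pair_total_rate:
  assumes "2 \<le> L" "d 0 = 0"
  shows "(\<Sum>x\<in>particles L (adjacent_pair L). d (headway L (adjacent_pair L) x)) = d (L - 2)"
proof -
  have P: "particles L (adjacent_pair L) = {0, 1}"
    using assms by (auto simp: particles_def adjacent_pair_def)
  have h0: "headway L (adjacent_pair L) 0 = 0"
    by (rule headway_eqI) (use assms in \<open>auto simp: adjacent_pair_def\<close>)
  define m where "m = L - 2"
  have L: "L = Suc (Suc m)" using assms by (simp add: m_def)
  have h1: "headway L (adjacent_pair L) 1 = L - 2"
    unfolding L by (rule headway_eqI) (auto simp: adjacent_pair_def)
  show ?thesis unfolding P using h0 h1 assms by simp
qed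

text \<open>
  The adjacent pair can only be entered by a jump across a headway 0 (rejoining itself) or 1.
\<close>

lemma rate_right_into_adjacent_pair:
  assumes "3 \<le> L" "d 0 = 0" "d 1 = 0" "x < L"
  shows "rate_right L d (exchange (adjacent_pair L) x ((x + 1) mod L)) x = 0"
proof -
  define \<xi> where "\<xi> = exchange (adjacent_pair L) x ((x + 1) mod L)"
  consider "x = 0" | "0 < x" "x + 1 < L" | "x + 1 = L" using assms by linarith
  then have "rate_right L d \<xi> x = 0"
  proof cases
    case 1
    have "headway L \<xi> x = 0"
      by (rule headway_eqI) (use 1 assms in \<open>auto simp: \<xi>_def exchange_def adjacent_pair_def\<close>)
    moreover have "x \<in> particles L \<xi>"
      using 1 assms by (auto simp: particles_def \<xi>_def exchange_def adjacent_pair_def)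
    ultimately show ?thesis using assms by (simp add: rate_right_particle)
  next
    case 2
    then show ?thesis
      using assms by (intro rate_right_vacant) (auto simp: \<xi>_def exchange_def adjacent_pair_def)
  next
    \<comment> \<open>The particle belonging at site 0 waits at \<open>L - 1\<close>, one empty site
      before the particle at 1.\<close>
    case 3
    have L: "L = Suc x" using 3 by simp
    have "headway L \<xi> x = 1"
      by (rule headway_eqI)
         (use assms in \<open>auto simp: L \<xi>_def exchange_def adjacent_pair_def mod_Suc\<close>)
    moreover have "x \<in> particles L \<xi>"
      using 3 assms by (auto simp: particles_def \<xi>_def exchange_def adjacent_pair_def)
    ultimately show ?thesis using assms by (simp add: rate_right_particle)
  qed
  then show ?thesis by (simp add: \<xi>_def)
qed

text \<open>Before a left jump into the pair, the jumping particle sits at 2 with headway 1 behind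
  it, or at 1 with headway 0 behind it (the exchange then changes nothing). For any other
  \<open>x\<close> the site is vacant.\<close>

lemma rate_left_into_adjacent_pair:
  assumes "3 \<le> L" "d 0 = 0" "d 1 = 0" "x < L"
  shows "rate_left L d (exchange (adjacent_pair L) x ((x + L - 1) mod L)) x = 0"
proof -
  define \<xi> where "\<xi> = exchange (adjacent_pair L) x ((x + L - 1) mod L)"
  have "(x + L - 1) mod L = (if x = 0 then L - 1 else x - 1)"
    using assms by (cases x) auto
  then have \<xi>: "\<xi> = exchange (adjacent_pair L) x (if x = 0 then L - 1 else x - 1)"
    by (simp add: \<xi>_def)
  consider "x = 0" | "x = 1" | "x = 2" | "2 < x" by linarith
  then have "rate_left L d \<xi> x = 0"
  proof cases
    case 2
    have h: "headway L \<xi> 0 = 0"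
      by (rule headway_eqI) (use 2 assms in \<open>auto simp: \<xi> exchange_def adjacent_pair_def\<close>)
    have p: "0 \<in> particles L \<xi>"
      using 2 assms by (auto simp: particles_def \<xi> exchange_def adjacent_pair_def)
    have "next_particle L \<xi> 0 = x"
      using 2 assms h by (simp add: next_particle_def)
    then show ?thesis using rate_left_next_particle[OF p, of d] h assms by simp
  next
    case 3
    have h: "headway L \<xi> 0 = 1"
      by (rule headway_eqI) (use 3 assms in \<open>auto simp: \<xi> exchange_def adjacent_pair_def\<close>)
    have p: "0 \<in> particles L \<xi>"
      using 3 assms by (auto simp: particles_def \<xi> exchange_def adjacent_pair_def)
    have "next_particle L \<xi> 0 = x"
      using 3 assms h by (simp add: next_particle_def)
    then show ?thesis using rate_left_next_particle[OF p, of d] h assms by simp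
  next
    case 1
    then show ?thesis
      using assms by (intro rate_left_vacant) (auto simp: \<xi> exchange_def adjacent_pair_def)
  next
    case 4
    then have "\<xi> x = adjacent_pair L (x - 1)" by (simp add: \<xi> exchange_def)
    then show ?thesis
      using 4 assms by (intro rate_left_vacant) (auto simp: adjacent_pair_def)
  qed
  then show ?thesis by (simp add: \<xi>_def)
qed

text \<open>All rates into the pair vanish, so only the loss term of the generator survives, and it
  is supported on the pair itself.\<close>

lemma hep_generator_indicator_adjacent_pair:
  assumes "3 \<le> L" "d 0 = 0" "d 1 = 0"
  shows "hep_generator r l d L (\<lambda>\<xi>. if \<xi> = adjacent_pair L then 1 else 0) \<eta> =
         (if \<eta> = adjacent_pair L then - ((r + l) * d (L - 2)) else 0)"
proof -
  let ?f = "\<lambda>\<xi>. if \<xi> = adjacent_pair L then 1 else 0 :: real"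
  have "rate_right L d \<eta> x * ?f (exchange \<eta> x ((x + 1) mod L)) = 0" if "x < L" for x
  proof (cases "exchange \<eta> x ((x + 1) mod L) = adjacent_pair L")
    case True
    \<comment> \<open>An exchange is an involution, so a state leading to the pair is obtained by
      exchanging the same sites in the pair.\<close>
    have "exchange (adjacent_pair L) x ((x + 1) mod L) = \<eta>"
      using exchange_exchange[of \<eta> x "(x + 1) mod L"] unfolding True .
    then have "rate_right L d \<eta> x = 0"
      using rate_right_into_adjacent_pair[OF assms that] by simp
    then show ?thesis by simp
  qed simp
  then have "(\<Sum>x<L. rate_right L d \<eta> x * ?f (exchange \<eta> x ((x + 1) mod L))) = 0"
    by (intro sum.neutral ballI) (simp only: lessThan_iff)
  moreover have "rate_left L d \<eta> x * ?f (exchange \<eta> x ((x + L - 1) mod L)) = 0" if "x < L" for x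
  proof (cases "exchange \<eta> x ((x + L - 1) mod L) = adjacent_pair L")
    case True
    have "exchange (adjacent_pair L) x ((x + L - 1) mod L) = \<eta>"
      using exchange_exchange[of \<eta> x "(x + L - 1) mod L"] unfolding True .
    then have "rate_left L d \<eta> x = 0"
      using rate_left_into_adjacent_pair[OF assms that] by simp
    then show ?thesis by simp
  qed simp
  then have "(\<Sum>x<L. rate_left L d \<eta> x * ?f (exchange \<eta> x ((x + L - 1) mod L))) = 0"
    by (intro sum.neutral ballI) (simp only: lessThan_iff)
  ultimately show ?thesis
    using adjacent_pair_total_rate[of L d] assms unfolding hep_generator_expand by simp
qed

text \<open>For \<open>r = l = 0\<close> nothing moves, and for \<open>z = 0\<close> states with two
  particles have measure zero; in both cases invariance would say nothing about \<open>w\<close>.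
  This is why \<open>r + l\<close> and \<open>z\<close> are taken positive.\<close>

lemma rates_of_potential_if_invariant:
  assumes rl: "0 < r + l" and w: "jump_rates w"
    and J: "interaction_potential J" "\<And>k. 1 \<le> k \<Longrightarrow> J k \<noteq> \<infinity>" and z: "0 < z"
    and inv: "\<And>L. 3 \<le> L \<Longrightarrow> hep_invariant_on r l w L (Omega_can L 2) (mu_gc J L z)"
  shows "\<exists>c>0. rates_of_potential J c w"
proof -
  define c where "c = w 1 * exp (- real_of_ereal (J 2 - J 1))"
  define v where "v n = (if n = 0 then 0 else c * exp (real_of_ereal (J (n + 1) - J n)))" for n
  define d where "d n = w n - v n" for n
  have v: "rates_of_potential J c v" by (simp add: rates_of_potential_def v_def)
  have d0: "d 0 = 0" using w by (simp add: d_def v_def jump_rates_def)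
  have d1: "d 1 = 0"
    by (simp add: d_def v_def c_def numeral_2_eq_2 mult.assoc flip: exp_add)
  have "w b = v b" for b
  proof (cases "b = 0")
    case True
    then show ?thesis using d0 by (simp add: d_def)
  next
    case False
    \<comment> \<open>On this torus the gaps of the pair are 0 and \<open>b\<close>, so its exit
      rate isolates \<open>d b\<close>.\<close>
    define L where "L = b + 2"
    have L: "3 \<le> L" using False by (simp add: L_def)
    let ?\<mu> = "mu_gc J L z" and ?f = "\<lambda>\<xi>. if \<xi> = adjacent_pair L then 1 else 0 :: real"
    have "hep_invariant_on r l v L (Omega_can L 2) ?\<mu>"
      by (rule hep_invariant_on_mu_gc[OF J v Omega_can_subset]) (auto intro: exchange_in_Omega_can)
    then have "(\<Sum>\<eta>\<in>Omega_can L 2. ?\<mu> \<eta> * hep_generator r l d L ?f \<eta>) = 0"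
      using inv[OF L] unfolding hep_invariant_on_iff[OF Omega_can_subset] d_def hep_generator_diff
      by (simp add: right_diff_distrib sum_subtractf)
    also have "(\<Sum>\<eta>\<in>Omega_can L 2. ?\<mu> \<eta> * hep_generator r l d L ?f \<eta>) =
        (\<Sum>\<eta>\<in>Omega_can L 2. if \<eta> = adjacent_pair L then - ?\<mu> \<eta> * (r + l) * d (L - 2) else 0)"
      using hep_generator_indicator_adjacent_pair[of L d r l] L d0 d1
      by (intro sum.cong refl) (simp add: algebra_simps)
    also have "\<dots> = - ?\<mu> (adjacent_pair L) * (r + l) * d b"
      using adjacent_pair_in_Omega_can[of L] L finite_subset[OF Omega_can_subset finite_Omega_gc]
      by (simp add: L_def)
    finally have "?\<mu> (adjacent_pair L) * (r + l) * d b = 0" by simp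
    moreover have "0 < ?\<mu> (adjacent_pair L)"
      using adjacent_pair_in_Omega_can[of L] L Omega_can_subset by (intro mu_gc_pos J z) auto
    ultimately show ?thesis using rl by (simp add: d_def)
  qed
  then have "w = v" by blast
  moreover have "0 < c" using w by (simp add: c_def jump_rates_def)
  ultimately show ?thesis using v by blast
qed

theorem theorem3p5:
  fixes r l :: real
  assumes "0 \<le> r" and "0 \<le> l"
  shows "(\<forall>(J :: nat \<Rightarrow> ereal) (c :: real) (w :: nat \<Rightarrow> real).
            interaction_potential J \<and> (\<forall>k\<ge>1. J k \<noteq> \<infinity>) \<and> 0 < c \<and> rates_of_potential J c w \<longrightarrow>
            (\<forall>L\<ge>1. \<forall>z\<ge>0.
               hep_invariant_on r l w L (Omega_gc L) (mu_gc J L z) \<and>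
               (\<forall>N\<le>L. hep_invariant_on r l w L (Omega_can L N) (mu_gc J L z))))
       \<and>
         (\<forall>(J :: nat \<Rightarrow> ereal) (w :: nat \<Rightarrow> real) (z :: real).
            0 < r + l \<and> jump_rates w \<and>
            interaction_potential J \<and> (\<forall>k\<ge>1. J k \<noteq> \<infinity>) \<and> 0 < z \<and>
            (\<forall>L\<ge>1. \<forall>N\<le>L. hep_invariant_on r l w L (Omega_can L N) (mu_gc J L z)) \<longrightarrow>
            (\<exists>c>0. rates_of_potential J c w))"
proof (intro conjI allI impI; elim conjE)
  fix J :: "nat \<Rightarrow> ereal" and c z :: real and w :: "nat \<Rightarrow> real" and L :: nat
  assume J: "interaction_potential J" "\<forall>k\<ge>1. J k \<noteq> \<infinity>" and w: "rates_of_potential J c w"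
  show "hep_invariant_on r l w L (Omega_gc L) (mu_gc J L z)"
    using J w by (intro hep_invariant_on_mu_gc) (auto intro: exchange_in_Omega_gc)
  fix N
  show "hep_invariant_on r l w L (Omega_can L N) (mu_gc J L z)"
    using J w Omega_can_subset
    by (intro hep_invariant_on_mu_gc) (auto intro: exchange_in_Omega_can)
next
  fix J :: "nat \<Rightarrow> ereal" and w :: "nat \<Rightarrow> real" and z :: real
  assume "0 < r + l" "jump_rates w" "interaction_potential J" "\<forall>k\<ge>1. J k \<noteq> \<infinity>" "0 < z"
    "\<forall>L\<ge>1. \<forall>N\<le>L. hep_invariant_on r l w L (Omega_can L N) (mu_gc J L z)"
  then show "\<exists>c>0. rates_of_potential J c w"
    by (intro rates_of_potential_if_invariant[of r l w J z]) auto
qed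

end
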